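(* Let $G$ be a finite group with abelianization $G^{\mathrm{ab}}=G/G'$. If $|G^{\mathrm{ab}}|$ is divisible by $3$, then $\mathrm{Pol}_s(G)$ is non-amenable for every integer $s\ge 3$.
   Context: For groups $G,H$, a map $f:G\to H$ and $g\in G$, define $\partial_g f:G\to H$ by $(\partial_g f)(x)=f(gx)f(x)^{-1}$, and put $\partial_{g_1,\ldots,g_k}f=\partial_{g_1}(\partial_{g_2}(\cdots\partial_{g_k}f))$. Universal polynomial group: for $s\ge1$, let $F_G$ be the free group on the symbols $\{x_g : g\in G\setminus\{1\}\}$, set $x_1=1$, and let $\iota:G\to F_G$, $\iota(g)=x_g$. Let $R_s(G)$ be the normal closure in $F_G$ of all elements $(\partial_{g_1,\ldots,g_{s+1}}\iota)(1)$, $g_1,\ldots,g_{s+1}\in G$. Then $\mathrm{Pol}_s(G)=F_G/R_s(G)$. *)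

theory Defs
  imports "HOL-Algebra.Algebra"
begin

section \<open>Free groups\<close>

text \<open>A letter \<open>(x, True)\<close> stands for the generator \<open>x\<close> and \<open>(x, False)\<close> for its formal inverse.
  The free group on a set is realised on its freely reduced words.\<close>

type_synonym 'a word = "('a \<times> bool) list"

definition flip :: "'a \<times> bool \<Rightarrow> 'a \<times> bool" where
  "flip l = (fst l, \<not> snd l)"

definition reduced :: "'a word \<Rightarrow> bool" where
  "reduced w \<longleftrightarrow> successively (\<lambda>l m. m \<noteq> flip l) w"

fun push :: "'a \<times> bool \<Rightarrow> 'a word \<Rightarrow> 'a word" where
  "push l [] = [l]"
| "push l (m # w) = (if m = flip l then w else l # m # w)"

text \<open>For reduced words \<open>u\<close> and \<open>v\<close>, \<open>foldr push u v\<close> is the reduced form of \<open>u @ v\<close>.\<close>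

definition free_group :: "'a set \<Rightarrow> 'a word monoid" where
  "free_group S =
    \<lparr>carrier = {w. reduced w \<and> fst ` set w \<subseteq> S},
     monoid.mult = (\<lambda>u v. foldr push u v),
     one = []\<rparr>"

definition generator :: "'a \<Rightarrow> 'a word" where
  "generator x = [(x, True)]"

lemma flip_flip [simp]: "flip (flip l) = l"
  by (simp add: flip_def)

lemma fst_flip [simp]: "fst (flip l) = fst l"
  by (simp add: flip_def)

lemma reduced_Nil [simp]: "reduced []"
  by (simp add: reduced_def)

lemma reduced_Cons: "reduced (l # w) \<longleftrightarrow> reduced w \<and> (w = [] \<or> hd w \<noteq> flip l)"
  by (cases w) (auto simp: reduced_def)

lemma reduced_push: "reduced w \<Longrightarrow> reduced (push l w)"
  by (cases w) (auto simp: reduced_Cons)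

lemma reduced_foldr_push: "reduced v \<Longrightarrow> reduced (foldr push u v)"
  by (induction u) (auto simp: reduced_push)

lemma set_push: "set (push l w) \<subseteq> insert l (set w)"
  by (cases w) auto

lemma set_foldr_push: "set (foldr push u v) \<subseteq> set u \<union> set v"
  by (induction u) (use set_push in fastforce)+

lemma push_flip_push: "reduced w \<Longrightarrow> push l (push (flip l) w) = w"
  by (cases w; cases "tl w") (auto simp: reduced_Cons)

lemma foldr_push_push:
  assumes "reduced w" shows "foldr push (push l v) w = push l (foldr push v w)"
proof (cases v)
  case (Cons m u)
  then show ?thesis
    using push_flip_push[OF reduced_foldr_push[OF assms, of u], of l] by auto
qed simp

lemma foldr_push_assoc:
  "reduced w \<Longrightarrow> foldr push (foldr push u v) w = foldr push u (foldr push v w)"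
  by (induction u) (simp_all add: foldr_push_push)

lemma foldr_push_Nil: "reduced u \<Longrightarrow> foldr push u [] = u"
proof (induction u)
  case (Cons l u)
  then show ?case by (cases u) (auto simp: reduced_Cons)
qed simp

lemma foldr_push_inverse: "reduced v \<Longrightarrow> foldr push (rev (map flip u)) (foldr push u v) = v"
proof (induction u)
  case (Cons l u)
  then show ?case
    using push_flip_push[OF reduced_foldr_push[of v u], of "flip l"] by simp
qed simp

lemma group_free_group: "group (free_group S)"
proof (rule groupI)
  fix u v assume "u \<in> carrier (free_group S)" "v \<in> carrier (free_group S)"
  then show "u \<otimes>\<^bsub>free_group S\<^esub> v \<in> carrier (free_group S)"
    using set_foldr_push[of u v] by (fastforce simp: free_group_def reduced_foldr_push)
next
  fix u assume u: "u \<in> carrier (free_group S)"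
  let ?v = "foldr push (rev (map flip u)) []"
  have "?v \<in> carrier (free_group S)"
    using u set_foldr_push[of "rev (map flip u)" "[]"]
    by (fastforce simp: free_group_def reduced_foldr_push)
  moreover have "?v \<otimes>\<^bsub>free_group S\<^esub> u = \<one>\<^bsub>free_group S\<^esub>"
    using u foldr_push_assoc[of u "rev (map flip u)" "[]"] foldr_push_inverse[of "[]" u]
    by (simp add: free_group_def foldr_push_Nil)
  ultimately show "\<exists>v\<in>carrier (free_group S). v \<otimes>\<^bsub>free_group S\<^esub> u = \<one>\<^bsub>free_group S\<^esub>"
    by blast
qed (auto simp: free_group_def foldr_push_assoc)


section \<open>Normal closure\<close>

definition normal_closure :: "('a, 'b) monoid_scheme \<Rightarrow> 'a set \<Rightarrow> 'a set" where
  "normal_closure G S = \<Inter> {N. N \<lhd> G \<and> S \<subseteq> N}"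

lemma (in group) normal_normal_closure:
  assumes "S \<subseteq> carrier G" shows "normal_closure G S \<lhd> G"
proof -
  have *: "carrier G \<lhd> G"
    by (simp add: normal_inv_iff subgroup_self)
  have "subgroup (normal_closure G S) G"
    unfolding normal_closure_def using * assms
    by (intro subgroups_Inter) (auto intro: normal_imp_subgroup)
  then show ?thesis
    by (auto simp: normal_inv_iff normal_closure_def)
qed


section \<open>The universal polynomial group\<close>

definition group_deriv ::
  "('a, 'c) monoid_scheme \<Rightarrow> ('b, 'd) monoid_scheme \<Rightarrow> 'a \<Rightarrow> ('a \<Rightarrow> 'b) \<Rightarrow> 'a \<Rightarrow> 'b" where
  "group_deriv G H g f = (\<lambda>x. f (g \<otimes>\<^bsub>G\<^esub> x) \<otimes>\<^bsub>H\<^esub> inv\<^bsub>H\<^esub> (f x))"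

definition group_derivs ::
  "('a, 'c) monoid_scheme \<Rightarrow> ('b, 'd) monoid_scheme \<Rightarrow> 'a list \<Rightarrow> ('a \<Rightarrow> 'b) \<Rightarrow> 'a \<Rightarrow> 'b" where
  "group_derivs G H gs f = foldr (group_deriv G H) gs f"

definition Pol_free :: "('a, 'c) monoid_scheme \<Rightarrow> 'a word monoid" where
  "Pol_free G = free_group (carrier G - {\<one>\<^bsub>G\<^esub>})"

definition Pol_iota :: "('a, 'c) monoid_scheme \<Rightarrow> 'a \<Rightarrow> 'a word" where
  "Pol_iota G g = (if g = \<one>\<^bsub>G\<^esub> then \<one>\<^bsub>Pol_free G\<^esub> else generator g)"

definition Pol_relators :: "nat \<Rightarrow> ('a, 'c) monoid_scheme \<Rightarrow> 'a word set" where
  "Pol_relators s G =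
    {group_derivs G (Pol_free G) gs (Pol_iota G) \<one>\<^bsub>G\<^esub> | gs.
       length gs = s + 1 \<and> set gs \<subseteq> carrier G}"

definition Pol :: "nat \<Rightarrow> ('a, 'c) monoid_scheme \<Rightarrow> 'a word set monoid" where
  "Pol s G = Pol_free G Mod normal_closure (Pol_free G) (Pol_relators s G)"

lemma group_Pol_free: "group (Pol_free G)"
  by (simp add: Pol_free_def group_free_group)

lemma Pol_iota_closed: "g \<in> carrier G \<Longrightarrow> Pol_iota G g \<in> carrier (Pol_free G)"
  by (auto simp: Pol_iota_def Pol_free_def free_group_def generator_def reduced_Cons)

lemma group_derivs_closed:
  assumes "group G" "group H" "f \<in> carrier G \<rightarrow> carrier H" "set gs \<subseteq> carrier G"
  shows "group_derivs G H gs f \<in> carrier G \<rightarrow> carrier H"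
proof -
  interpret G: group G by fact
  interpret H: group H by fact
  show ?thesis
    using assms(3,4)
    by (induction gs) (auto simp: group_derivs_def group_deriv_def Pi_iff)
qed

lemma Pol_relators_closed:
  assumes "group G" shows "Pol_relators s G \<subseteq> carrier (Pol_free G)"
proof -
  interpret G: group G by fact
  have "Pol_iota G \<in> carrier G \<rightarrow> carrier (Pol_free G)"
    by (simp add: Pol_iota_closed)
  from group_derivs_closed[OF assms group_Pol_free this] show ?thesis
    unfolding Pol_relators_def by fastforce
qed

lemma group_Pol:
  assumes "group G" shows "group (Pol s G)"
  unfolding Pol_def
  by (intro normal.factorgroup_is_group group.normal_normal_closure group_Pol_free
      Pol_relators_closed assms)


section \<open>Amenability of discrete groups\<close>

definition amenable :: "('a, 'b) monoid_scheme \<Rightarrow> bool" where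
  "amenable G \<longleftrightarrow>
    (\<exists>\<mu> :: 'a set \<Rightarrow> real.
       (\<forall>A. A \<subseteq> carrier G \<longrightarrow> \<mu> A \<ge> 0) \<and>
       \<mu> (carrier G) = 1 \<and>
       (\<forall>A B. A \<subseteq> carrier G \<longrightarrow> B \<subseteq> carrier G \<longrightarrow> A \<inter> B = {} \<longrightarrow> \<mu> (A \<union> B) = \<mu> A + \<mu> B) \<and>
       (\<forall>g A. g \<in> carrier G \<longrightarrow> A \<subseteq> carrier G \<longrightarrow> \<mu> (g <#\<^bsub>G\<^esub> A) = \<mu> A))"

end

theory Submission
  imports Defs
begin

text \<open>
  A homomorphism from \<open>G\<close> onto \<open>\<int>/3\<close> pulls polynomial maps on \<open>\<int>/3\<close> back to polynomial maps on \<open>G\<close>, so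
  it suffices to find a map \<open>f\<close> of degree 3 from \<open>\<int>/3\<close> to the permutations of a set, with
  \<open>f 0 = id\<close>, such that no finitely additive probability measure on that set is invariant under
  \<open>p = f 1\<close> and \<open>f 2\<close>. Writing \<open>f 2 = \<alpha> p\<^sup>2\<close> and \<open>d = \<alpha>\<^sup>-\<^sup>1 p \<alpha> p\<^sup>2\<close>, the map \<open>f\<close> has degree 3 as soon as
  \<open>\<alpha>\<^sup>3 = d\<^sup>3 = 1\<close> and \<open>\<alpha> d = d \<alpha>\<close>.

  These relations are realised on nine copies of a set with an action of \<open>\<int>/3 * \<int>/3 = \<langle>a\<rangle> * \<langle>b\<rangle>\<close>,
  indexed by \<open>(j, i)\<close> with \<open>j\<close> and \<open>i\<close> modulo 3: \<open>\<alpha>\<close> shifts \<open>j\<close>, and \<open>d\<close> acts by \<open>a\<close>, \<open>b\<close>, \<open>a\<close> on the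
  copies with \<open>i = 0, 1, 2\<close>. For \<open>j = 0\<close> the permutation \<open>p\<close> shifts \<open>i\<close>, acting by \<open>a\<^sup>-\<^sup>1\<close> from \<open>i = 0\<close>
  to \<open>i = 1\<close> and trivially otherwise; the definition of \<open>d\<close> then forces \<open>d p\<^sup>-\<^sup>2\<close> for \<open>j = 1\<close> and \<open>d (d p\<^sup>-\<^sup>2)\<^sup>-\<^sup>2\<close> for \<open>j = 2\<close>, and
  it is consistent when \<open>j\<close> returns to 0. On the copy \<open>(0, 1)\<close>, \<open>d\<close> acts by \<open>b\<close> and \<open>p d p\<^sup>-\<^sup>1\<close> by \<open>a\<close>, and the
  ping-pong partition of this copy leaves no room for a non-zero invariant measure.
\<close>

section \<open>Invariant means from amenable permutation groups\<close>

lemma carrier_BijGroup_UNIV: "carrier (BijGroup UNIV) = {f. bij f}"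
  by (simp add: BijGroup_def Bij_def)

lemma one_BijGroup_UNIV: "\<one>\<^bsub>BijGroup UNIV\<^esub> = id"
  by (simp add: BijGroup_def id_def restrict_def)

lemma mult_BijGroup_UNIV: "bij f \<Longrightarrow> bij g \<Longrightarrow> f \<otimes>\<^bsub>BijGroup UNIV\<^esub> g = f \<circ> g"
  by (simp add: BijGroup_def Bij_def compose_def comp_def restrict_def)

lemma inv_BijGroup_UNIV: "bij f \<Longrightarrow> inv\<^bsub>BijGroup UNIV\<^esub> f = inv_into UNIV f"
  by (subst inv_BijGroup) (auto simp: Bij_def)

lemmas BijGroup_UNIV =
  carrier_BijGroup_UNIV one_BijGroup_UNIV mult_BijGroup_UNIV inv_BijGroup_UNIV

text \<open>The mean is pushed forward along the orbit map \<open>k \<mapsto> \<psi> k x\<close> of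
  an arbitrary point \<open>x\<close>; left translation by \<open>h\<close> turns into the action of
  \<open>\<psi> h\<close>.\<close>

lemma amenable_invariant_mean:
  assumes "amenable K" "group K" and hom: "\<psi> \<in> hom K (BijGroup (UNIV :: 'x set))"
  obtains m :: "'x set \<Rightarrow> real"
  where "\<And>A. m A \<ge> 0" "m UNIV = 1" "\<And>A B. A \<inter> B = {} \<Longrightarrow> m (A \<union> B) = m A + m B"
    "\<And>k A. k \<in> carrier K \<Longrightarrow> m (\<psi> k ` A) = m A"
proof -
  interpret K: group K by fact
  obtain \<mu> :: "'a set \<Rightarrow> real" where \<mu>:
    "\<forall>A. A \<subseteq> carrier K \<longrightarrow> \<mu> A \<ge> 0"
    "\<mu> (carrier K) = 1"
    "\<forall>A B. A \<subseteq> carrier K \<longrightarrow> B \<subseteq> carrier K \<longrightarrow> A \<inter> B = {} \<longrightarrow> \<mu> (A \<union> B) = \<mu> A + \<mu> B"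
    "\<forall>g A. g \<in> carrier K \<longrightarrow> A \<subseteq> carrier K \<longrightarrow> \<mu> (g <#\<^bsub>K\<^esub> A) = \<mu> A"
    using assms(1) unfolding amenable_def by (elim exE conjE) (rule that; assumption)
  have bij: "bij (\<psi> k)" if "k \<in> carrier K" for k
    using hom_in_carrier[OF hom that] by (simp add: BijGroup_UNIV)
  have comp: "\<psi> (k \<otimes>\<^bsub>K\<^esub> l) = \<psi> k \<circ> \<psi> l" if "k \<in> carrier K" "l \<in> carrier K" for k l
    using hom_mult[OF hom that] that by (simp add: BijGroup_UNIV bij)
  fix x :: 'x
  define orb where "orb A = {k \<in> carrier K. \<psi> k x \<in> A}" for A
  have "orb (\<psi> h ` A) = h <#\<^bsub>K\<^esub> orb A" if h: "h \<in> carrier K" for h A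
  proof (intro equalityI subsetI)
    fix k assume "k \<in> orb (\<psi> h ` A)"
    then obtain y where k: "k \<in> carrier K" and y: "y \<in> A" "\<psi> k x = \<psi> h y"
      by (auto simp: orb_def)
    let ?l = "inv\<^bsub>K\<^esub> h \<otimes>\<^bsub>K\<^esub> k"
    have hl: "h \<otimes>\<^bsub>K\<^esub> ?l = k"
      using h k by (simp add: K.m_assoc[symmetric])
    have "\<psi> h (\<psi> ?l x) = \<psi> h y"
      using comp[of h ?l] h k hl y by simp
    then have "\<psi> ?l x = y"
      using bij[OF h] by (simp add: bij_is_inj inj_eq)
    then have "?l \<in> orb A"
      using h k y by (simp add: orb_def)
    then show "k \<in> h <#\<^bsub>K\<^esub> orb A"
      using hl unfolding l_coset_def by blast
  qed (auto simp: l_coset_def orb_def comp h)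
  moreover have "orb A \<subseteq> carrier K" for A
    by (auto simp: orb_def)
  moreover have "orb UNIV = carrier K"
    by (auto simp: orb_def)
  moreover have "orb (A \<union> B) = orb A \<union> orb B" "A \<inter> B = {} \<Longrightarrow> orb A \<inter> orb B = {}" for A B
    by (auto simp: orb_def)
  ultimately show thesis
    using that[of "\<lambda>A. \<mu> (orb A)"] \<mu> by simp
qed


section \<open>Homomorphisms from the universal polynomial group\<close>

definition word_eval :: "('b, 'c) monoid_scheme \<Rightarrow> ('a \<Rightarrow> 'b) \<Rightarrow> 'a word \<Rightarrow> 'b" where
  "word_eval H F w =
    foldr (\<lambda>l x. (if snd l then F (fst l) else inv\<^bsub>H\<^esub> F (fst l)) \<otimes>\<^bsub>H\<^esub> x) w \<one>\<^bsub>H\<^esub>"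

context group
begin

lemma word_eval_simps:
  "word_eval G F [] = \<one>"
  "word_eval G F (l # w) = (if snd l then F (fst l) else inv F (fst l)) \<otimes> word_eval G F w"
  by (simp_all add: word_eval_def)

lemma word_eval_closed:
  assumes "F \<in> S \<rightarrow> carrier G" "fst ` set w \<subseteq> S" shows "word_eval G F w \<in> carrier G"
  using assms(2) by (induction w) (use assms(1) in \<open>auto simp: word_eval_simps Pi_iff\<close>)

lemma word_eval_push:
  assumes F: "F \<in> S \<rightarrow> carrier G" and "fst l \<in> S" "fst ` set w \<subseteq> S"
  shows "word_eval G F (push l w) = word_eval G F (l # w)"
proof (cases w)
  case (Cons m v)
  have "fst l \<in> S" "F (fst l) \<in> carrier G" "word_eval G F v \<in> carrier G"
    using assms Cons word_eval_closed[OF F, of v] by auto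
  then show ?thesis
    using Cons by (auto simp: word_eval_simps flip_def m_assoc[symmetric])
qed simp

lemma word_eval_foldr_push:
  assumes F: "F \<in> S \<rightarrow> carrier G" and "fst ` set u \<subseteq> S" "fst ` set v \<subseteq> S"
  shows "word_eval G F (foldr push u v) = word_eval G F u \<otimes> word_eval G F v"
  using assms(2)
proof (induction u)
  case Nil
  then show ?case using word_eval_closed[OF F assms(3)] by (simp add: word_eval_simps)
next
  case (Cons l u)
  have "fst ` set (foldr push u v) \<subseteq> S"
    using set_foldr_push[of u v] Cons.prems assms(3) by fastforce
  moreover have "F (fst l) \<in> carrier G"
    using F Cons.prems by auto
  ultimately show ?case
    using Cons word_eval_push[OF F, of l "foldr push u v"]
      word_eval_closed[OF F, of u] word_eval_closed[OF F, of v] assms(3)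
    by (auto simp: word_eval_simps m_assoc)
qed

lemma word_eval_hom:
  assumes "F \<in> S \<rightarrow> carrier G" shows "word_eval G F \<in> hom (free_group S) G"
  using word_eval_closed[OF assms] word_eval_foldr_push[OF assms]
  by (intro homI) (auto simp: free_group_def)

end

lemma group_derivs_hom:
  assumes "\<phi> \<in> hom K H" "group G" "group K" "group H" "F \<in> carrier G \<rightarrow> carrier K"
    and "set gs \<subseteq> carrier G" "x \<in> carrier G"
  shows "\<phi> (group_derivs G K gs F x) = group_derivs G H gs (\<phi> \<circ> F) x"
  using assms(6,7)
proof (induction gs arbitrary: x)
  case (Cons g gs)
  interpret G: group G by fact
  interpret h: group_hom K H \<phi>
    using assms by (simp add: group_hom_def group_hom_axioms_def)
  have "group_derivs G K gs F y \<in> carrier K" if "y \<in> carrier G" for y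
    using group_derivs_closed[OF assms(2,3,5), of gs] Cons.prems that by auto
  then show ?case
    using Cons by (simp add: group_derivs_def group_deriv_def)
qed (simp add: group_derivs_def)

text \<open>Evaluation of words at \<open>F\<close> kills the relators, so it factors through the
  quotient by their normal closure.\<close>

lemma Pol_universal:
  assumes "group G" "group H" "F \<in> carrier G \<rightarrow> carrier H" "F \<one>\<^bsub>G\<^esub> = \<one>\<^bsub>H\<^esub>"
    and derivs: "\<And>gs. length gs = s + 1 \<Longrightarrow> set gs \<subseteq> carrier G \<Longrightarrow>
      group_derivs G H gs F \<one>\<^bsub>G\<^esub> = \<one>\<^bsub>H\<^esub>"
  obtains \<psi> where "\<psi> \<in> hom (Pol s G) H" "F ` carrier G \<subseteq> \<psi> ` carrier (Pol s G)"
proof -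
  interpret G: group G by fact
  interpret H: group H by fact
  define \<phi> where "\<phi> = word_eval H F"
  have hom: "\<phi> \<in> hom (Pol_free G) H"
    using assms(3) unfolding \<phi>_def Pol_free_def by (intro H.word_eval_hom) auto
  interpret \<phi>: group_hom "Pol_free G" H \<phi>
    using hom group_Pol_free assms(2) by (simp add: group_hom_def group_hom_axioms_def)
  have \<iota>: "\<phi> (Pol_iota G g) = F g" if "g \<in> carrier G" for g
    using that assms(3,4) \<phi>.hom_one
    by (auto simp: Pol_iota_def generator_def \<phi>_def H.word_eval_simps Pi_iff)
  let ?R = "Pol_relators s G" and ?N = "normal_closure (Pol_free G) (Pol_relators s G)"
  have "\<phi> r = \<one>\<^bsub>H\<^esub>" if r_in: "r \<in> ?R" for r
  proof -
    obtain gs where gs: "length gs = s + 1" "set gs \<subseteq> carrier G"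
      and r: "r = group_derivs G (Pol_free G) gs (Pol_iota G) \<one>\<^bsub>G\<^esub>"
      using r_in unfolding Pol_relators_def by blast
    have "\<phi> r = group_derivs G H gs (\<phi> \<circ> Pol_iota G) \<one>\<^bsub>G\<^esub>"
      unfolding r using hom gs by (intro group_derivs_hom group_Pol_free assms)
        (auto simp: Pol_iota_closed)
    \<comment> \<open>\<open>\<phi> \<circ> Pol_iota G\<close> and \<open>F\<close> agree only on
      the carrier, and derivatives involve shifted points, so the induction runs over all carrier
      points.\<close>
    also have "\<dots> = group_derivs G H gs F x" if "x = \<one>\<^bsub>G\<^esub>" for x
    proof -
      have "group_derivs G H gs (\<phi> \<circ> Pol_iota G) x = group_derivs G H gs F x"
        if "x \<in> carrier G" for x
        using gs(2) that
        by (induction gs arbitrary: x) (auto simp: group_derivs_def group_deriv_def \<iota>)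
      then show ?thesis using that by simp
    qed
    finally show ?thesis using derivs[OF gs] by simp
  qed
  then have "?R \<subseteq> kernel (Pol_free G) H \<phi>"
    using Pol_relators_closed[OF assms(1)] by (auto simp: kernel_def)
  then have ker: "?N \<subseteq> kernel (Pol_free G) H \<phi>"
    unfolding normal_closure_def using \<phi>.normal_kernel by blast
  have N: "?N \<lhd> Pol_free G"
    by (intro group.normal_normal_closure group_Pol_free Pol_relators_closed assms)
  have "\<phi> x = \<phi> y" if "x \<in> carrier (Pol_free G)" "y \<in> carrier (Pol_free G)"
    and eq: "?N #>\<^bsub>Pol_free G\<^esub> x = ?N #>\<^bsub>Pol_free G\<^esub> y" for x y
  proof -
    have "x \<in> ?N #>\<^bsub>Pol_free G\<^esub> y"
      using \<phi>.rcos_self[OF that(1) normal_imp_subgroup[OF N]] eq by simp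
    then obtain n where "n \<in> ?N" "x = n \<otimes>\<^bsub>Pol_free G\<^esub> y"
      by (auto simp: r_coset_def)
    then show ?thesis
      using ker that(2) by (auto simp: kernel_def)
  qed
  then obtain \<psi> where \<psi>: "\<psi> \<in> hom (Pol s G) H"
    "\<And>x. x \<in> carrier (Pol_free G) \<Longrightarrow> \<psi> (?N #>\<^bsub>Pol_free G\<^esub> x) = \<phi> x"
    using FactGroup_universal[OF hom N] unfolding Pol_def by metis
  show thesis
  proof (rule that[OF \<psi>(1)], rule image_subsetI)
    fix g assume "g \<in> carrier G"
    then show "F g \<in> \<psi> ` carrier (Pol s G)"
      using \<psi>(2)[OF Pol_iota_closed] Pol_iota_closed \<iota>
      by (auto simp: Pol_def carrier_FactGroup image_iff intro!: bexI[of _ "Pol_iota G g"])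
  qed
qed


section \<open>Homomorphisms onto the group of order three\<close>

datatype z3 = Zero | One | Two

lemma all_z3: "(\<forall>k. R k) \<longleftrightarrow> R Zero \<and> R One \<and> R Two"
  by (metis z3.exhaust)

fun nxt :: "z3 \<Rightarrow> z3" where
  "nxt Zero = One"
| "nxt One = Two"
| "nxt Two = Zero"

fun z3_add :: "z3 \<Rightarrow> z3 \<Rightarrow> z3" where
  "z3_add Zero k = k"
| "z3_add One k = nxt k"
| "z3_add Two k = nxt (nxt k)"

definition z3_group :: "z3 monoid" where
  "z3_group = \<lparr>carrier = UNIV, monoid.mult = z3_add, one = Zero\<rparr>"

lemma group_z3_group: "group z3_group"
proof (rule groupI)
  fix k l m :: z3
  show "k \<otimes>\<^bsub>z3_group\<^esub> l \<otimes>\<^bsub>z3_group\<^esub> m = k \<otimes>\<^bsub>z3_group\<^esub> (l \<otimes>\<^bsub>z3_group\<^esub> m)"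
    by (cases k; cases l; cases m) (simp_all add: z3_group_def)
  show "\<exists>l\<in>carrier z3_group. l \<otimes>\<^bsub>z3_group\<^esub> k = \<one>\<^bsub>z3_group\<^esub>"
    by (cases k) (auto simp: z3_group_def intro: exI[of _ Zero] exI[of _ One] exI[of _ Two])
qed (simp_all add: z3_group_def)

context comm_group
begin

text \<open>\<open>G/B\<close> has exponent 3, and by maximality each of its non-trivial subgroups
  contains the class of \<open>x\<close>. Hence \<open>B\<close>, \<open>x B\<close> and
  \<open>x^-1 B\<close> are all the cosets.\<close>

lemma hom_z3_of_maximal_subgroup:
  assumes B: "subgroup B G" and x: "x \<in> carrier G" "x \<notin> B"
    and cube: "\<And>y. y \<in> carrier G \<Longrightarrow> y [^] (3::int) \<in> B"
    and max: "\<And>C. subgroup C G \<Longrightarrow> B \<subseteq> C \<Longrightarrow> x \<notin> C \<Longrightarrow> C = B"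
  obtains \<pi> where "\<pi> \<in> hom G z3_group" "\<pi> x = One"
proof -
  interpret B: subgroup B G by fact
  note [simp] = B.mem_carrier
  define xp where "xp k = (case k of Zero \<Rightarrow> \<one> | One \<Rightarrow> x | Two \<Rightarrow> inv x)" for k
  have xp_closed [simp]: "xp k \<in> carrier G" for k
    using x by (cases k) (auto simp: xp_def)
  have x3: "x \<otimes> (x \<otimes> x) \<in> B"
  proof -
    have "x [^] (3::int) = x \<otimes> (x \<otimes> x)"
      using x int_pow_mult[of x 1 2] int_pow_mult[of x 1 1] by simp
    then show ?thesis using cube[OF x(1)] by simp
  qed
  have xx: "x \<otimes> x \<notin> B"
  proof
    assume "x \<otimes> x \<in> B"
    then have "x \<otimes> (x \<otimes> x) \<otimes> inv (x \<otimes> x) \<in> B"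
      using x3 by simp
    then show False
      using x by (simp add: m_assoc)
  qed
  have xp_add: "\<exists>c\<in>B. xp k \<otimes> xp l = c \<otimes> xp (z3_add k l)" for k l
  proof -
    have "x \<otimes> x = x \<otimes> (x \<otimes> x) \<otimes> inv x" "inv x \<otimes> inv x = inv (x \<otimes> (x \<otimes> x)) \<otimes> x"
      using x by (simp_all add: m_assoc inv_mult_group)
    then consider "xp k \<otimes> xp l = \<one> \<otimes> xp (z3_add k l)"
      | "xp k \<otimes> xp l = x \<otimes> (x \<otimes> x) \<otimes> xp (z3_add k l)"
      | "xp k \<otimes> xp l = inv (x \<otimes> (x \<otimes> x)) \<otimes> xp (z3_add k l)"
      using x by (cases k; cases l) (simp_all add: xp_def)
    then show ?thesis
      using x3 B.one_closed B.m_inv_closed by cases blast+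
  qed
  have cover: "\<exists>k. \<exists>b\<in>B. y = b \<otimes> xp k" if y: "y \<in> carrier G" for y
  proof (cases "y \<in> B")
    case True
    then show ?thesis using y by (intro exI[of _ Zero] bexI[of _ y]) (auto simp: xp_def)
  next
    case False
    let ?C = "B <#> generate G {y}"
    have gen: "subgroup (generate G {y}) G"
      using y by (intro generate_is_subgroup) auto
    have C: "subgroup ?C G"
      by (intro mult_subgroups B gen)
    have "B \<subseteq> ?C"
    proof
      fix b assume "b \<in> B"
      then show "b \<in> ?C"
        using subgroup.one_closed[OF gen] unfolding set_mult_def by force
    qed
    moreover have "\<one> \<otimes> y \<in> ?C"
      using B.one_closed generate.incl[of y "{y}" G] unfolding set_mult_def by blast
    ultimately have "x \<in> ?C"
      using max[OF C] False y by auto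
    then obtain b and n :: int where b: "b \<in> B" "x = b \<otimes> y [^] n"
      using y by (auto simp: set_mult_def generate_pow)
    \<comment> \<open>Rounding \<open>n\<close> to the nearest multiple of 3 leaves -1, 0 or 1; the
      multiple is absorbed into \<open>B\<close> as a cube. Remainder 0 would put \<open>x\<close>
      in \<open>B\<close>.\<close>
    define q where "q = (n + 1) div 3"
    define c where "c = b \<otimes> (y [^] q) [^] (3::int)"
    have c: "c \<in> B"
      unfolding c_def using b y by (intro B.m_closed cube) auto
    have "n = q * 3 - 1 \<or> n = q * 3 \<or> n = q * 3 + 1"
      unfolding q_def by presburger
    then consider "n = q * 3 - 1" | "n = q * 3" | "n = q * 3 + 1"
      by blast
    then show ?thesis
    proof cases
      case 1
      have "x = c \<otimes> inv y"
        using y b unfolding 1 c_def by (simp add: int_pow_pow int_pow_diff m_assoc)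
      then have "x \<otimes> y = c"
        using y c by (simp add: m_assoc)
      then have "y = c \<otimes> inv x"
        using x(1) y by (simp add: m_comm[of x y] m_assoc flip: \<open>x \<otimes> y = c\<close>)
      then show ?thesis
        using c by (intro exI[of _ Two]) (auto simp: xp_def)
    next
      case 2
      have "x = c"
        using y b unfolding 2 c_def by (simp add: int_pow_pow)
      then show ?thesis using c x by simp
    next
      case 3
      have "x = c \<otimes> y"
        using y b unfolding 3 c_def by (simp add: int_pow_pow int_pow_mult m_assoc)
      then have "y = inv c \<otimes> x"
        using y c by (simp add: m_assoc[symmetric])
      then show ?thesis
        using c by (intro exI[of _ One]) (auto simp: xp_def)
    qed
  qed
  have uniq: "k = l" if "b \<in> B" "c \<in> B" "b \<otimes> xp k = c \<otimes> xp l" for b c k l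
  proof -
    have "inv c \<otimes> b = inv c \<otimes> (b \<otimes> xp k) \<otimes> inv (xp k)"
      using that(1,2) by (simp add: m_assoc)
    also have "\<dots> = inv c \<otimes> (c \<otimes> xp l) \<otimes> inv (xp k)"
      by (simp only: that(3))
    also have "\<dots> = xp l \<otimes> inv (xp k)"
      using that(1,2) by (simp add: m_assoc[symmetric])
    finally have "inv c \<otimes> b = xp l \<otimes> inv (xp k)" .
    moreover have "inv c \<otimes> b \<in> B"
      using that by simp
    ultimately have *: "xp l \<otimes> inv (xp k) \<in> B"
      by simp
    then have "inv (xp l \<otimes> inv (xp k)) \<in> B"
      by (rule B.m_inv_closed)
    then have "xp k \<otimes> inv (xp l) \<in> B"
      by (simp add: inv_mult_group)
    with * show ?thesis
      using x xx by (cases k; cases l) (auto simp: xp_def)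
  qed
  define \<pi> where "\<pi> y = (THE k. \<exists>b\<in>B. y = b \<otimes> xp k)" for y
  have \<pi>: "\<pi> (b \<otimes> xp k) = k" if "b \<in> B" for b k
    unfolding \<pi>_def using that uniq by blast
  show thesis
  proof
    show "\<pi> \<in> hom G z3_group"
    proof (rule homI)
      fix y z assume "y \<in> carrier G" "z \<in> carrier G"
      then obtain k l b c where y: "b \<in> B" "y = b \<otimes> xp k" and z: "c \<in> B" "z = c \<otimes> xp l"
        using cover by metis
      obtain d where d: "d \<in> B" "xp k \<otimes> xp l = d \<otimes> xp (z3_add k l)"
        using xp_add by blast
      have "y \<otimes> z = (b \<otimes> c) \<otimes> (xp k \<otimes> xp l)"
        using y z by (simp add: m_ac)
      also have "\<dots> = (b \<otimes> c \<otimes> d) \<otimes> xp (z3_add k l)"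
        using y z d by (simp add: m_assoc)
      finally show "\<pi> (y \<otimes> z) = \<pi> y \<otimes>\<^bsub>z3_group\<^esub> \<pi> z"
        using \<pi> y z d by (simp add: z3_group_def)
    qed (simp add: z3_group_def)
    show "\<pi> x = One"
      using \<pi>[OF B.one_closed, of One] x by (simp add: xp_def)
  qed
qed

text \<open>Cubing kills an element of order 3, so on a finite group it is not onto. Some
  \<open>x\<close> is thus no cube, and a subgroup containing all cubes is chosen maximal among
  those missing \<open>x\<close>.\<close>

lemma ex_hom_onto_z3:
  assumes fin: "finite (carrier G)" and "3 dvd order G"
  obtains \<pi> x where "\<pi> \<in> hom G z3_group" "x \<in> carrier G" "\<pi> x = One"
proof -
  define cb where "cb y = y [^] (3::int)" for y
  have hom: "cb \<in> hom G G"
    by (intro homI) (auto simp: cb_def int_pow_distrib)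
  interpret cb: group_hom G G cb
    using hom by unfold_locales
  obtain m where "order G = 3 ^ 1 * m"
    using assms(2) by auto
  then obtain H where H: "subgroup H G" "card H = 3"
    using sylow_thm[of 3 G 1 m] fin by (auto simp: is_group)
  interpret H: subgroup H G by fact
  have "H \<noteq> {\<one>}"
    using H(2) by auto
  then obtain h where h: "h \<in> H" "h \<noteq> \<one>"
    using H.one_closed by blast
  have "h [^] (3::nat) = \<one>"
    using group.pow_order_eq_1[OF H.subgroup_is_group[OF is_group]] h H(2)
    by (simp add: order_def nat_pow_consistent[symmetric])
  then have "cb h = cb \<one>"
    using int_pow_int[of G h 3] by (simp add: cb_def)
  then have "\<not> inj_on cb (carrier G)"
    using inj_onD[of cb "carrier G" h \<one>] h(2) H.mem_carrier[OF h(1)] by auto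
  then have "cb ` carrier G \<noteq> carrier G"
    using fin eq_card_imp_inj_on[of "carrier G" cb] by auto
  then obtain x where x: "x \<in> carrier G" "x \<notin> cb ` carrier G"
    using cb.hom_closed by blast
  let ?\<S> = "{C. subgroup C G \<and> cb ` carrier G \<subseteq> C \<and> x \<notin> C}"
  have "finite ?\<S>"
    by (rule finite_subset[of _ "Pow (carrier G)"]) (auto dest: subgroup.subset simp: fin)
  moreover have "cb ` carrier G \<in> ?\<S>"
    using x cb.img_is_subgroup by simp
  ultimately have "\<exists>B\<in>?\<S>. \<forall>C\<in>?\<S>. B \<subseteq> C \<longrightarrow> B = C"
    by (intro finite_has_maximal) auto
  then obtain B where B: "subgroup B G" "cb ` carrier G \<subseteq> B" "x \<notin> B"
    and max: "\<forall>C\<in>?\<S>. B \<subseteq> C \<longrightarrow> B = C"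
    by blast
  obtain \<pi> where "\<pi> \<in> hom G z3_group" "\<pi> x = One"
  proof (rule hom_z3_of_maximal_subgroup[OF B(1) x(1) B(3)])
    show "y [^] (3::int) \<in> B" if "y \<in> carrier G" for y
      using B(2) that by (auto simp: cb_def)
    show "C = B" if "subgroup C G" "B \<subseteq> C" "x \<notin> C" for C
      using max B(2) that by auto
  qed
  then show thesis
    using that x(1) by blast
qed

end


section \<open>Maps factoring through the group of order three\<close>

text \<open>A triple stands for the function on \<open>\<int>/3\<close> with these values at 0, 1 and 2.\<close>

fun tri :: "'b \<times> 'b \<times> 'b \<Rightarrow> z3 \<Rightarrow> 'b" where
  "tri (u, v, w) Zero = u"
| "tri (u, v, w) One = v"
| "tri (u, v, w) Two = w"

fun tri_deriv :: "('b, 'c) monoid_scheme \<Rightarrow> z3 \<Rightarrow> 'b \<times> 'b \<times> 'b \<Rightarrow> 'b \<times> 'b \<times> 'b" where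
  "tri_deriv H Zero t = (\<one>\<^bsub>H\<^esub>, \<one>\<^bsub>H\<^esub>, \<one>\<^bsub>H\<^esub>)"
| "tri_deriv H One (u, v, w) =
    (v \<otimes>\<^bsub>H\<^esub> inv\<^bsub>H\<^esub> u, w \<otimes>\<^bsub>H\<^esub> inv\<^bsub>H\<^esub> v, u \<otimes>\<^bsub>H\<^esub> inv\<^bsub>H\<^esub> w)"
| "tri_deriv H Two (u, v, w) =
    (w \<otimes>\<^bsub>H\<^esub> inv\<^bsub>H\<^esub> u, u \<otimes>\<^bsub>H\<^esub> inv\<^bsub>H\<^esub> v, v \<otimes>\<^bsub>H\<^esub> inv\<^bsub>H\<^esub> w)"

text \<open>The values \<open>u\<close>, \<open>c u\<close>, \<open>c\<^sup>2 u\<close> with \<open>c\<^sup>3 = 1\<close>: these are the functions of degree at most 1.\<close>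

fun affine_tri :: "('b, 'c) monoid_scheme \<Rightarrow> 'b \<times> 'b \<times> 'b \<Rightarrow> bool" where
  "affine_tri H (u, v, w) \<longleftrightarrow> {u, v, w} \<subseteq> carrier H \<and>
    v \<otimes>\<^bsub>H\<^esub> inv\<^bsub>H\<^esub> u = w \<otimes>\<^bsub>H\<^esub> inv\<^bsub>H\<^esub> v \<and> w \<otimes>\<^bsub>H\<^esub> inv\<^bsub>H\<^esub> v = u \<otimes>\<^bsub>H\<^esub> inv\<^bsub>H\<^esub> w"

context group
begin

lemma tri_deriv_closed:
  assumes "t \<in> carrier G \<times> carrier G \<times> carrier G"
  shows "tri_deriv G k t \<in> carrier G \<times> carrier G \<times> carrier G"
  using assms by (cases k) auto

lemma foldr_tri_deriv_closed:
  assumes "t \<in> carrier G \<times> carrier G \<times> carrier G"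
  shows "foldr (tri_deriv G) ks t \<in> carrier G \<times> carrier G \<times> carrier G"
  by (induction ks) (use assms tri_deriv_closed in auto)

lemma tri_deriv_one: "tri_deriv G k (\<one>, \<one>, \<one>) = (\<one>, \<one>, \<one>)"
  by (cases k) auto

lemma foldr_tri_deriv_one: "foldr (tri_deriv G) ks (\<one>, \<one>, \<one>) = (\<one>, \<one>, \<one>)"
  by (induction ks) (simp_all only: foldr.simps comp_apply id_apply tri_deriv_one)

text \<open>With c the common ratio, a first derivative is constant with value c, c^-1 or 1, and a
  constant has trivial derivatives.\<close>

lemma tri_deriv_affine:
  assumes "affine_tri G t" shows "tri_deriv G k (tri_deriv G l t) = (\<one>, \<one>, \<one>)"
proof -
  obtain u v w where t: "t = (u, v, w)" by (cases t)
  then have [simp]: "u \<in> carrier G" "v \<in> carrier G" "w \<in> carrier G"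
    and eq: "v \<otimes> inv u = w \<otimes> inv v" "w \<otimes> inv v = u \<otimes> inv w"
    using assms by auto
  have "inv (u \<otimes> inv w) = inv (v \<otimes> inv u)" "inv (v \<otimes> inv u) = inv (w \<otimes> inv v)"
    using eq by simp_all
  then have "w \<otimes> inv u = u \<otimes> inv v" "u \<otimes> inv v = v \<otimes> inv w"
    by (simp_all add: inv_mult_group)
  then show ?thesis
    using eq by (cases l; cases k) (simp_all add: t)
qed

end

text \<open>Shifting by \<open>g\<close> before the homomorphism \<open>\<pi>\<close> is shifting by
  \<open>\<pi> g\<close> after it.\<close>

lemma group_derivs_tri:
  assumes "group G" "group H" "\<pi> \<in> hom G z3_group"
    and t: "t \<in> carrier H \<times> carrier H \<times> carrier H"
    and "set gs \<subseteq> carrier G" "x \<in> carrier G"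
  shows "group_derivs G H gs (\<lambda>x. tri t (\<pi> x)) x
    = tri (foldr (tri_deriv H) (map \<pi> gs) t) (\<pi> x)"
  using assms(5,6)
proof (induction gs arbitrary: x)
  case (Cons g gs)
  interpret G: group G by fact
  interpret H: group H by fact
  obtain u v w where *: "foldr (tri_deriv H) (map \<pi> gs) t = (u, v, w)"
    using prod_cases3 by blast
  then have "u \<in> carrier H" "v \<in> carrier H" "w \<in> carrier H"
    using H.foldr_tri_deriv_closed[OF t, of "map \<pi> gs"] by auto
  moreover have "\<pi> (g \<otimes>\<^bsub>G\<^esub> x) = z3_add (\<pi> g) (\<pi> x)"
    using hom_mult[OF assms(3)] Cons.prems by (simp add: z3_group_def)
  ultimately show ?case
    using Cons * by (cases "\<pi> g"; cases "\<pi> x") (simp_all add: group_derivs_def group_deriv_def)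
qed (simp add: group_derivs_def)


section \<open>A cubic map with non-amenable image\<close>

text \<open>The lists are the cosets of \<open>\<langle>b\<rangle>\<close> in \<open>\<langle>a\<rangle> * \<langle>b\<rangle>\<close>, where \<open>a\<close> and \<open>b\<close> have order 3 and act as
  \<open>turn True\<close> and \<open>turn False\<close>. The last letter of a list is a power of \<open>a\<close> and the factors alternate, so
  odd lists start in \<open>\<langle>a\<rangle>\<close> and even ones in \<open>\<langle>b\<rangle>\<close>; \<open>True\<close> and \<open>False\<close> are the exponents 1 and 2.\<close>

definition turn :: "bool \<Rightarrow> bool list \<Rightarrow> bool list" where
  "turn e w = (if even (length w) = e then True # w
    else case w of [] \<Rightarrow> [] | l # v \<Rightarrow> if l then False # v else v)"

lemma turn_turn_turn [simp]: "turn e (turn e (turn e w)) = w"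
  by (auto simp: turn_def split: list.splits)

abbreviation (input) "ta \<equiv> turn True"
abbreviation (input) "tb \<equiv> turn False"

type_synonym point = "z3 \<times> z3 \<times> bool list"

fun alpha :: "point \<Rightarrow> point" where
  "alpha (j, i, w) = (nxt j, i, w)"

text \<open>As a^3 = 1, \<open>ta (ta w)\<close> is a^-1 applied to \<open>w\<close>, and likewise
  for b. With p_j for p on the copies of first index j, identified along \<open>alpha\<close>, the
  later rows solve \<open>p_(j+1) = d p_j^-2\<close>.\<close>

fun gen_p :: "point \<Rightarrow> point" where
  "gen_p (Zero, Zero, w) = (Zero, One, ta (ta w))"
| "gen_p (Zero, One, w) = (Zero, Two, w)"
| "gen_p (Zero, Two, w) = (Zero, Zero, w)"
| "gen_p (One, Zero, w) = (One, One, tb w)"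
| "gen_p (One, One, w) = (One, Two, ta (ta w))"
| "gen_p (One, Two, w) = (One, Zero, ta (ta w))"
| "gen_p (Two, Zero, w) = (Two, One, tb (ta (ta w)))"
| "gen_p (Two, One, w) = (Two, Two, ta (ta (tb (tb w))))"
| "gen_p (Two, Two, w) = (Two, Zero, ta (tb (tb (ta w))))"

fun gen_p' :: "point \<Rightarrow> point" where
  "gen_p' (Zero, One, w) = (Zero, Zero, ta w)"
| "gen_p' (Zero, Two, w) = (Zero, One, w)"
| "gen_p' (Zero, Zero, w) = (Zero, Two, w)"
| "gen_p' (One, One, w) = (One, Zero, tb (tb w))"
| "gen_p' (One, Two, w) = (One, One, ta w)"
| "gen_p' (One, Zero, w) = (One, Two, ta w)"
| "gen_p' (Two, One, w) = (Two, Zero, ta (tb (tb w)))"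
| "gen_p' (Two, Two, w) = (Two, One, tb (ta w))"
| "gen_p' (Two, Zero, w) = (Two, Two, ta (ta (tb (ta (ta w)))))"

abbreviation (input) gen_q :: "point \<Rightarrow> point" where
  "gen_q \<equiv> alpha \<circ> gen_p \<circ> gen_p"

abbreviation (input) gen_q' :: "point \<Rightarrow> point" where
  "gen_q' \<equiv> gen_p' \<circ> gen_p' \<circ> alpha \<circ> alpha"

lemma gen_inverse:
  "gen_p \<circ> gen_p' = id" "gen_p' \<circ> gen_p = id"
  "gen_q \<circ> gen_q' = id" "gen_q' \<circ> gen_q = id"
  by (simp_all add: fun_eq_iff all_z3)

lemma bij_gen: "bij gen_p" "bij gen_p'" "bij gen_q" "bij gen_q'"
  using gen_inverse o_bij by blast+

lemma inv_gen: "inv_into UNIV gen_p = gen_p'" "inv_into UNIV gen_p' = gen_p"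
  "inv_into UNIV gen_q = gen_q'" "inv_into UNIV gen_q' = gen_q"
  using gen_inverse inv_unique_comp by blast+

text \<open>For \<open>k = l = One\<close> the triple is
  \<open>(alpha, d^-1 alpha, alpha d)\<close>, with common ratio d^-1 as d^3 = 1 and d commutes with
  \<open>alpha\<close>. All pairs of directions are checked pointwise.\<close>

lemma affine_second_derivs:
  "affine_tri (BijGroup UNIV) (tri_deriv (BijGroup UNIV) k (tri_deriv (BijGroup UNIV) l (id, gen_p, gen_q)))"
proof -
  define q q' where "q = gen_q" and "q' = gen_q'"
  have bij [simp]: "bij gen_p" "bij gen_p'" "bij q" "bij q'"
    and inv [simp]: "inv_into UNIV gen_p = gen_p'" "inv_into UNIV gen_p' = gen_p"
      "inv_into UNIV q = q'" "inv_into UNIV q' = q"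
    unfolding q_def q'_def by (fact bij_gen inv_gen)+
  note [simp] = BijGroup_UNIV bij_comp o_inv_distrib
  have "affine_tri (BijGroup UNIV) (tri_deriv (BijGroup UNIV) k (tri_deriv (BijGroup UNIV) l (id, gen_p, q)))"
    by (cases k; cases l) (simp_all, simp_all add: q_def q'_def fun_eq_iff all_z3)
  then show ?thesis
    by (simp only: q_def)
qed

lemma foldr_tri_deriv_gen:
  assumes "length ks \<ge> 4"
  shows "foldr (tri_deriv (BijGroup UNIV)) ks (id, gen_p, gen_q) = (id, id, id)"
proof -
  interpret group "BijGroup (UNIV :: point set)" by (rule group_BijGroup)
  \<comment> \<open>\<open>foldr\<close> applies the last entries first: the last two reach an
    affine triple, the two before them kill it, and any earlier ones act on the trivial
    triple.\<close>
  define ls where "ls = drop (length ks - 4) ks"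
  have "length ls = 4"
    using assms by (simp add: ls_def)
  then obtain k1 k2 k3 k4 where ls: "ls = [k1, k2, k3, k4]"
    by (auto simp: eval_nat_numeral length_Suc_conv)
  have "foldr (tri_deriv (BijGroup UNIV)) ls (id, gen_p, gen_q) = (id, id, id)"
    using tri_deriv_affine[OF affine_second_derivs]
    by (simp only: ls foldr.simps comp_apply id_apply one_BijGroup_UNIV)
  moreover have "ks = take (length ks - 4) ks @ ls"
    by (simp add: ls_def)
  ultimately show ?thesis
    using foldr_tri_deriv_one by (metis comp_apply foldr_append one_BijGroup_UNIV)
qed

lemma no_invariant_mean:
  fixes m :: "point set \<Rightarrow> real"
  assumes nonneg: "\<And>A. m A \<ge> 0" and total: "m UNIV = 1"
    and add: "\<And>A B. A \<inter> B = {} \<Longrightarrow> m (A \<union> B) = m A + m B"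
    and p: "\<And>A. m (gen_p ` A) = m A" and q: "\<And>A. m (gen_q ` A) = m A"
  shows False
proof -
  have mono: "m A \<le> m B" if "A \<subseteq> B" for A B
    using add[of A "B - A"] nonneg[of "B - A"] that by (simp add: Un_absorb1)
  have p': "m (gen_p' ` A) = m A" for A
    using p[of "gen_p' ` A"] gen_inverse(1) by (simp add: image_comp)
  have al: "m (alpha ` A) = m A" for A
  proof -
    have "gen_q ` gen_p' ` gen_p' ` A = alpha ` A"
    proof -
      have "gen_q \<circ> gen_p' \<circ> gen_p' = alpha"
        by (simp add: fun_eq_iff all_z3)
      then show ?thesis by (metis image_comp)
    qed
    then show ?thesis using q p' by metis
  qed
  \<comment> \<open>\<open>alpha \<circ> alpha\<close> is the inverse of \<open>alpha\<close>. On
    the copy \<open>(Zero, One)\<close>, \<open>e\<close> passes through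
    \<open>(Zero, Zero)\<close>, where \<open>d\<close> acts by a; the twists of
    \<open>gen_p'\<close> and \<open>gen_p\<close> cancel, so \<open>e\<close> acts by a as
    well.\<close>
  define d where "d = alpha \<circ> alpha \<circ> gen_p \<circ> alpha \<circ> gen_p \<circ> gen_p"
  define e where "e = gen_p \<circ> d \<circ> gen_p'"
  have d: "m (d ` A) = m A" for A
    unfolding d_def image_comp[symmetric] by (simp only: al p)
  have e: "m (e ` A) = m A" for A
    unfolding e_def image_comp[symmetric] by (simp only: d p p')
  define copy where "copy j i S = (\<lambda>w. (j, i, w)) ` S" for j i :: z3 and S :: "bool list set"
  define \<nu> where "\<nu> S = m (copy Zero One S)" for S
  have "e ` copy Zero One S = copy Zero One (ta ` S)" "d ` copy Zero One S = copy Zero One (tb ` S)" for S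
    by (simp_all add: copy_def image_image d_def e_def)
  then have inva: "\<nu> (turn c ` S) = \<nu> S" for c S
    using d e unfolding \<nu>_def by (cases c) metis+
  have \<nu>_add: "\<nu> (S \<union> T) = \<nu> S + \<nu> T" if "S \<inter> T = {}" for S T
    unfolding \<nu>_def copy_def image_Un using that by (intro add) auto
  have \<nu>_mono: "\<nu> S \<le> \<nu> T" if "S \<subseteq> T" for S T
    unfolding \<nu>_def copy_def using that by (intro mono) auto
  define side where "side c = {w :: bool list. even (length w) = c}" for c
  \<comment> \<open>\<open>turn c\<close> and its square put \<open>True\<close> and
    \<open>False\<close> in front of a list in \<open>side c\<close>, which gives two disjoint
    copies inside the other side. Used in both directions, this makes four times the mass of a side
    at most that mass.\<close>
  have double: "2 * \<nu> (side c) \<le> \<nu> (side (\<not> c))" for c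
  proof -
    have "turn c ` side c \<inter> turn c ` turn c ` side c = {}"
      "turn c ` side c \<union> turn c ` turn c ` side c \<subseteq> side (\<not> c)"
      by (auto simp: side_def turn_def)
    from \<nu>_add[OF this(1)] \<nu>_mono[OF this(2)] show ?thesis
      by (simp add: inva)
  qed
  have "\<nu> (side c) = 0" for c
    using double[of c] double[of "\<not> c"] nonneg[of "copy Zero One (side c)"] by (simp add: \<nu>_def)
  moreover have "side True \<inter> side False = {}" "side True \<union> side False = UNIV"
    by (auto simp: side_def)
  ultimately have "\<nu> UNIV = 0"
    using \<nu>_add[of "side True" "side False"] by simp
  \<comment> \<open>Masses cannot decrease along the cycles of \<open>i\<close> and
    \<open>j\<close>; following these to \<open>(Zero, One)\<close> bounds every copy by the null
    one.\<close>
  have "gen_p ` copy j i UNIV \<subseteq> copy j (nxt i) UNIV" for j i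
    by (cases j; cases i) (auto simp: copy_def)
  then have row: "m (copy j i UNIV) \<le> m (copy j (nxt i) UNIV)" for i j
    using mono p by metis
  have "alpha ` copy j i UNIV \<subseteq> copy (nxt j) i UNIV" for j i
    by (auto simp: copy_def)
  then have col: "m (copy j i UNIV) \<le> m (copy (nxt j) i UNIV)" for i j
    using mono al by metis
  have "m (copy j One UNIV) \<le> 0" for j
    using \<open>\<nu> UNIV = 0\<close> col[of One One] col[of Two One] unfolding \<nu>_def by (cases j) auto
  then have null: "m (copy j i UNIV) \<le> 0" for j i
    using row[of j Zero] row[of j Two] by (cases i) (auto intro: order_trans)
  have sub: "m (A \<union> B) \<le> m A + m B" for A B
    using add[of A "B - A"] mono[of "B - A" B] by (simp add: Diff_subset)
  have row_null: "m (copy j Zero UNIV \<union> copy j One UNIV \<union> copy j Two UNIV) \<le> 0" (is "m (?R j) \<le> 0") for j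
    using sub[of "copy j Zero UNIV \<union> copy j One UNIV" "copy j Two UNIV"]
      sub[of "copy j Zero UNIV" "copy j One UNIV"] null[of j Zero] null[of j One] null[of j Two]
    by linarith
  have "\<forall>x. x \<in> ?R Zero \<union> ?R One \<union> ?R Two"
    by (simp add: all_z3 copy_def)
  then have "?R Zero \<union> ?R One \<union> ?R Two = UNIV"
    by blast
  then show False
    using sub[of "?R Zero \<union> ?R One" "?R Two"] sub[of "?R Zero" "?R One"] row_null[of Zero]
      row_null[of One] row_null[of Two] total
    by simp
qed

theorem proposition7p1:
  fixes G :: "('a, 'b) monoid_scheme" and s :: nat
  assumes "group G" and "finite (carrier G)"
    and "3 dvd order (G Mod derived G (carrier G))"
    and "s \<ge> 3"
  shows "\<not> amenable (Pol s G)"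
proof
  assume amenable: "amenable (Pol s G)"
  interpret G: group G by fact
  let ?D = "derived G (carrier G)"
  have D: "?D \<lhd> G"
    by (rule G.derived_self_is_normal)
  have "finite (carrier (G Mod ?D))"
    using assms(2) by (simp add: carrier_FactGroup)
  then obtain \<pi>' y where \<pi>': "\<pi>' \<in> hom (G Mod ?D) z3_group" "y \<in> carrier (G Mod ?D)" "\<pi>' y = One"
    using comm_group.ex_hom_onto_z3[OF G.derived_quot_is_comm_group _ assms(3)] by blast
  define \<pi> where "\<pi> = \<pi>' \<circ> (\<lambda>g. ?D #>\<^bsub>G\<^esub> g)"
  have \<pi>: "\<pi> \<in> hom G z3_group"
    unfolding \<pi>_def by (intro hom_compose[OF normal.r_coset_hom_Mod[OF D] \<pi>'(1)])
  obtain g where g: "g \<in> carrier G" "\<pi> g = One"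
    using \<pi>'(2,3) by (auto simp: carrier_FactGroup \<pi>_def)
  \<comment> \<open>\<open>F\<close> takes the values \<open>gen_p\<close> at \<open>g\<close> and
    \<open>gen_q\<close> at its square, so both permutations lie in the image of the universal
    group.\<close>
  have gg: "\<pi> (g \<otimes>\<^bsub>G\<^esub> g) = Two"
    using hom_mult[OF \<pi> g(1) g(1)] g(2) by (simp add: z3_group_def)
  have \<pi>_one: "\<pi> \<one>\<^bsub>G\<^esub> = Zero"
    using hom_one[OF \<pi> assms(1) group_z3_group] by (simp add: z3_group_def)
  let ?H = "BijGroup (UNIV :: point set)" and ?t = "(id, gen_p, gen_q)"
  define F where "F x = tri ?t (\<pi> x)" for x
  have t: "?t \<in> carrier ?H \<times> carrier ?H \<times> carrier ?H"
    using bij_gen by (simp add: carrier_BijGroup_UNIV)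
  have "F x \<in> carrier ?H" for x
    using t by (cases "\<pi> x") (auto simp: F_def)
  then have F: "F \<in> carrier G \<rightarrow> carrier ?H"
    by simp
  have F_one: "F \<one>\<^bsub>G\<^esub> = \<one>\<^bsub>?H\<^esub>"
    by (simp add: F_def \<pi>_one one_BijGroup_UNIV)
  have derivs: "group_derivs G ?H gs F \<one>\<^bsub>G\<^esub> = \<one>\<^bsub>?H\<^esub>"
    if "length gs = s + 1" "set gs \<subseteq> carrier G" for gs
    using group_derivs_tri[OF assms(1) group_BijGroup \<pi> t that(2) G.one_closed]
      foldr_tri_deriv_gen[of "map \<pi> gs"] that(1) assms(4)
    by (simp add: F_def[abs_def] \<pi>_one one_BijGroup_UNIV)
  obtain \<psi> where \<psi>: "\<psi> \<in> hom (Pol s G) ?H" "F ` carrier G \<subseteq> \<psi> ` carrier (Pol s G)"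
    by (rule Pol_universal[OF assms(1) group_BijGroup F F_one derivs])
  show False
  proof (rule amenable_invariant_mean[OF amenable group_Pol[OF assms(1)] \<psi>(1)])
    fix m :: "point set \<Rightarrow> real"
    assume m: "\<And>A. m A \<ge> 0" "m UNIV = 1" "\<And>A B. A \<inter> B = {} \<Longrightarrow> m (A \<union> B) = m A + m B"
      and inva: "\<And>k A. k \<in> carrier (Pol s G) \<Longrightarrow> m (\<psi> k ` A) = m A"
    have F_inva: "m (F x ` A) = m A" if x: "x \<in> carrier G" for x A
    proof -
      obtain k where "k \<in> carrier (Pol s G)" "F x = \<psi> k"
        using \<psi>(2) x by blast
      then show ?thesis using inva by simp
    qed
    have "m (gen_p ` A) = m A" "m (gen_q ` A) = m A" for A
      using F_inva[of g A] F_inva[of "g \<otimes>\<^bsub>G\<^esub> g" A] g gg by (simp_all add: F_def)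
    then show False
      by - (rule no_invariant_mean[OF m]; simp)
  qed
qed

end
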